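(* Let $\{i,j,k\}=T=\{0,1,2\}$. For all $n\in\mathbb{N}_0$, the minimal cost $d_{n+1,k}$ of moving a tower of $n+1$ discs from the perfect state $i^{n+1}$ to the perfect state $j^{n+1}$ satisfies $$d_{n+1,k}=\min\left\{d_{n,i}+d_{n,j}+w_{n,k},\; 3d_{n,k}+w_{n,i}+w_{n,j}\right\},$$ with initial condition $d_{0,k}=0$.
   Context: Weighted Tower of Hanoi: $\mathbb{N}_0$ denotes the nonnegative integers; $T=\{0,1,2\}$ is the set of pegs; discs are labelled $1,2,3,\dots$ by increasing size. A state with $n$ discs is an assignment of the discs $1,\dots,n$ to the pegs, the discs on each peg being stacked with smaller discs above larger ones. A legal move transfers the topmost (smallest) disc of one peg to a different peg carrying no smaller disc. For $i\in T$, $i^n$ is the perfect state with all $n$ discs on peg $i$. For $\{i,j,k\}=T$ and $n\in\mathbb{N}_0$, $w_{n,k}\in[0,\infty)$ is a given cost of a single move of disc $n+1$ between pegs $i$ and $j$ (in either direction; $k$ is the idle peg of the move), and $d_{n,k}$ is the minimal total cost, over all finite sequences of legal moves, of getting from $i^n$ to $j^n$ with $n$ discs (independent of which of the two pegs other than $k$ is the start, since costs do not depend on the direction of a move). *)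

theory Defs
  imports Complex_Main "HOL-Library.FuncSet"
begin

definition pegs :: "nat set" where
  "pegs = {0, 1, 2}"

text \<open>A state only records the peg of each disc in \<open>{1..n}\<close>: the order of the discs on a peg
  is forced, so the topmost disc of a peg is the smallest disc assigned to it.\<close>

definition states :: "nat \<Rightarrow> (nat \<Rightarrow> nat) set" where
  "states n = {1..n} \<rightarrow>\<^sub>E pegs"

definition perfect :: "nat \<Rightarrow> nat \<Rightarrow> nat \<Rightarrow> nat" where
  "perfect n i = (\<lambda>d\<in>{1..n}. i)"

definition legal_move :: "nat \<Rightarrow> (nat \<Rightarrow> nat) \<Rightarrow> nat \<Rightarrow> nat \<Rightarrow> bool" where
  "legal_move n s d q \<longleftrightarrow> s \<in> states n \<and> d \<in> {1..n} \<and> q \<in> pegs \<and> q \<noteq> s d \<and>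
     (\<forall>e\<in>{1..n}. e < d \<longrightarrow> s e \<noteq> s d \<and> s e \<noteq> q)"

definition idle_peg :: "nat \<Rightarrow> nat \<Rightarrow> nat" where
  "idle_peg p q = (THE r. r \<in> pegs \<and> r \<noteq> p \<and> r \<noteq> q)"

text \<open>The weight \<open>w m r\<close> is the cost of a move of disc \<open>m + 1\<close> with idle peg \<open>r\<close>, whence the
  index \<open>d - 1\<close> below. The proposition \<open>move_seq w n s c t\<close> says that some finite sequence of
  legal moves of total cost \<open>c\<close> leads from \<open>s\<close> to \<open>t\<close>.\<close>

inductive move_seq ::
  "(nat \<Rightarrow> nat \<Rightarrow> real) \<Rightarrow> nat \<Rightarrow> (nat \<Rightarrow> nat) \<Rightarrow> real \<Rightarrow> (nat \<Rightarrow> nat) \<Rightarrow> bool"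
  for w :: "nat \<Rightarrow> nat \<Rightarrow> real" and n :: nat where
  empty: "s \<in> states n \<Longrightarrow> move_seq w n s 0 s"
| step: "move_seq w n s c t \<Longrightarrow> legal_move n t d q \<Longrightarrow>
     move_seq w n s (c + w (d - 1) (idle_peg (t d) q)) (t(d := q))"

definition min_cost :: "(nat \<Rightarrow> nat \<Rightarrow> real) \<Rightarrow> nat \<Rightarrow> (nat \<Rightarrow> nat) \<Rightarrow> (nat \<Rightarrow> nat) \<Rightarrow> real" where
  "min_cost w n s t = (LEAST c. move_seq w n s c t)"

text \<open>The two pegs other than \<open>k\<close> are taken in a fixed order here; \<open>tower_cost_eq\<close> below shows
  that the order is immaterial, and \<open>min_cost_attained\<close> that the minimum exists.\<close>

definition tower_cost :: "(nat \<Rightarrow> nat \<Rightarrow> real) \<Rightarrow> nat \<Rightarrow> nat \<Rightarrow> real" where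
  "tower_cost w n k = min_cost w n (perfect n ((k + 1) mod 3)) (perfect n ((k + 2) mod 3))"

lemma idle_peg_commute: "idle_peg p q = idle_peg q p"
  unfolding idle_peg_def by (rule arg_cong[of _ _ The]) auto

lemma idle_peg_eq:
  assumes "{i, j, k} = pegs"
  shows "idle_peg i j = k"
proof -
  have "card {i, j, k} = 3" using assms by (simp add: pegs_def)
  hence "i \<noteq> j" "i \<noteq> k" "j \<noteq> k" by (auto simp: card_insert_if split: if_splits)
  thus ?thesis unfolding idle_peg_def using assms by (intro the_equality) auto
qed

lemma perfect_in_states: "i \<in> pegs \<Longrightarrow> perfect n i \<in> states n"
  by (auto simp: perfect_def states_def)

lemma legal_move_state: "legal_move n s d q \<Longrightarrow> s(d := q) \<in> states n"
  by (auto simp: legal_move_def states_def PiE_def extensional_def)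

lemma legal_move_reverse: "legal_move n s d q \<Longrightarrow> legal_move n (s(d := q)) d (s d)"
  using legal_move_state[of n s d q] by (auto simp: legal_move_def states_def)

lemma move_seq_states: "move_seq w n s c t \<Longrightarrow> s \<in> states n \<and> t \<in> states n"
  by (induction rule: move_seq.induct) (auto intro: legal_move_state simp del: fun_upd_apply)

lemma move_seq_append:
  assumes "move_seq w n t c' u" "move_seq w n s c t"
  shows "move_seq w n s (c + c') u"
  using assms
proof (induction rule: move_seq.induct)
  case (step a c' b d q)
  from move_seq.step[OF step.IH[OF step.prems] step.hyps(2)]
  show ?case by (simp only: add.assoc)
qed simp

lemma move_seq_single:
  assumes "legal_move n s d q"
  shows "move_seq w n s (w (d - 1) (idle_peg (s d) q)) (s(d := q))"
  using move_seq.step[OF move_seq.empty assms, of w] assms by (simp add: legal_move_def)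

lemma move_seq_reverse: "move_seq w n s c t \<Longrightarrow> move_seq w n t c s"
proof (induction rule: move_seq.induct)
  case (step s c t d q)
  have "move_seq w n (t(d := q)) (w (d - 1) (idle_peg (t d) q)) t"
    using move_seq_single[OF legal_move_reverse[OF step.hyps(2)], of w]
    by (simp add: idle_peg_commute)
  from move_seq_append[OF step.IH this] show ?case by (simp only: add.commute)
qed (rule move_seq.empty)

lemma min_cost_commute: "min_cost w n s t = min_cost w n t s"
proof -
  have "move_seq w n s c t \<longleftrightarrow> move_seq w n t c s" for c
    using move_seq_reverse by blast
  thus ?thesis by (simp add: min_cost_def)
qed

lemma tower_cost_eq:
  assumes "{i, j, k} = pegs"
  shows "tower_cost w n k = min_cost w n (perfect n i) (perfect n j)"
proof -
  have c: "card {i, j, k} = 3" using assms by (simp add: pegs_def)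
  hence d: "i \<noteq> j" "i \<noteq> k" "j \<noteq> k" by (auto simp: card_insert_if split: if_splits)
  have "i \<in> pegs" "j \<in> pegs" "k \<in> pegs" using assms by auto
  with d consider "i = (k + 1) mod 3" "j = (k + 2) mod 3" | "j = (k + 1) mod 3" "i = (k + 2) mod 3"
    unfolding pegs_def by auto
  thus ?thesis by cases (auto simp: tower_cost_def min_cost_commute)
qed

lemma move_seq_lift:
  assumes "p \<in> pegs" "move_seq w n s c t"
  shows "move_seq w (Suc n) (s(Suc n := p)) c (t(Suc n := p))"
  using assms(2)
proof (induction rule: move_seq.induct)
  case (empty s)
  thus ?case using assms(1)
    by (intro move_seq.empty) (auto simp: states_def PiE_def extensional_def)
next
  case (step s c t d q)
  have "legal_move (Suc n) (t(Suc n := p)) d q"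
    using step.hyps(2) assms(1) by (auto simp: legal_move_def states_def PiE_def extensional_def)
  moreover have "d \<noteq> Suc n" using step.hyps(2) by (auto simp: legal_move_def)
  ultimately show ?case
    using move_seq.step[OF step.IH, of d q]
    by (simp add: fun_upd_twist[of d "Suc n"] fun_upd_other del: fun_upd_apply)
qed

lemma perfect_Suc: "perfect (Suc n) i = (perfect n i)(Suc n := i)"
  by (auto simp: perfect_def)

lemma legal_move_largest:
  assumes "{i, j, k} = pegs"
  shows "legal_move (Suc n) ((perfect n k)(Suc n := i)) (Suc n) j"
proof -
  have "card {i, j, k} = 3" using assms by (simp add: pegs_def)
  hence "i \<noteq> j" "i \<noteq> k" "j \<noteq> k" by (auto simp: card_insert_if split: if_splits)
  moreover have "i \<in> pegs" "j \<in> pegs" "k \<in> pegs" using assms by auto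
  ultimately show ?thesis
    by (auto simp: legal_move_def states_def perfect_def PiE_def extensional_def)
qed

lemma move_seq_perfect:
  assumes "{i, j, k} = pegs"
  shows "\<exists>c. move_seq w n (perfect n i) c (perfect n j)"
  using assms
proof (induction n arbitrary: i j k)
  case 0
  have "perfect 0 i = perfect 0 j" by (auto simp: perfect_def)
  moreover have "perfect 0 j \<in> states 0" using 0 by (intro perfect_in_states) auto
  ultimately show ?case using move_seq.empty by metis
next
  case (Suc n)
  have p: "{i, k, j} = pegs" "{k, j, i} = pegs" "i \<in> pegs" "j \<in> pegs" using Suc.prems by auto
  obtain c1 where 1: "move_seq w n (perfect n i) c1 (perfect n k)" using Suc.IH p(1) by blast
  obtain c2 where 2: "move_seq w n (perfect n k) c2 (perfect n j)" using Suc.IH p(2) by blast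
  have 3: "move_seq w (Suc n) (perfect (Suc n) i) c1 ((perfect n k)(Suc n := i))"
    using move_seq_lift[OF p(3) 1] by (simp add: perfect_Suc)
  have 4: "move_seq w (Suc n) ((perfect n k)(Suc n := j)) c2 (perfect (Suc n) j)"
    using move_seq_lift[OF p(4) 2] by (simp add: perfect_Suc)
  have "move_seq w (Suc n) (perfect (Suc n) i)
      (c1 + w (Suc n - 1) (idle_peg i j)) ((perfect n k)(Suc n := j))"
    using move_seq.step[OF 3 legal_move_largest[OF Suc.prems]] by simp
  from move_seq_append[OF 4 this] show ?case by blast
qed

text \<open>Sums of elements of a finite set of nonnegative reals have only finitely many values below
  any bound, so every nonempty set of such sums has a least element.\<close>

inductive_set sums_of :: "real set \<Rightarrow> real set" for W :: "real set" where
  zero: "0 \<in> sums_of W"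
| add: "c \<in> sums_of W \<Longrightarrow> x \<in> W \<Longrightarrow> c + x \<in> sums_of W"

lemma sums_of_nonneg: "c \<in> sums_of W \<Longrightarrow> \<forall>x\<in>W. 0 \<le> x \<Longrightarrow> 0 \<le> c"
  by (induction rule: sums_of.induct) auto

lemma sums_of_insert:
  "c \<in> sums_of (insert x W) \<Longrightarrow> \<exists>b\<in>sums_of W. \<exists>m::nat. c = b + real m * x"
proof (induction rule: sums_of.induct)
  case zero
  have "(0::real) = 0 + real 0 * x" by simp
  thus ?case using sums_of.zero by blast
next
  case (add c y)
  from add.IH obtain b m where b: "b \<in> sums_of W" "c = b + real m * x" by blast
  show ?case
  proof (cases "y = x")
    case True
    hence "c + y = b + real (Suc m) * x" using b by (simp add: algebra_simps)
    thus ?thesis using b(1) by blast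
  next
    case False
    hence "y \<in> W" using add.hyps(2) by simp
    hence "b + y \<in> sums_of W" using sums_of.add[OF b(1)] by blast
    moreover have "c + y = (b + y) + real m * x" using b by simp
    ultimately show ?thesis by blast
  qed
qed

lemma finite_sums_of:
  assumes "finite W" "\<forall>x\<in>W. 0 \<le> x"
  shows "finite {c \<in> sums_of W. c \<le> C}"
  using assms
proof (induction W rule: finite_induct)
  case empty
  have "c = 0" if "c \<in> sums_of {}" for c using that by (cases rule: sums_of.cases) auto
  hence "{c \<in> sums_of {}. c \<le> C} \<subseteq> {0}" by auto
  thus ?case by (rule finite_subset) simp
next
  case (insert x W)
  let ?B = "{c \<in> sums_of W. c \<le> C}"
  have x: "0 \<le> x" and nn: "\<forall>x\<in>W. 0 \<le> x" and fin: "finite ?B" using insert by auto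
  have "{c \<in> sums_of (insert x W). c \<le> C} \<subseteq>
      (\<lambda>(b, m). b + real m * x) ` (?B \<times> {..nat \<lfloor>C / x\<rfloor>})"
  proof
    fix c assume "c \<in> {c \<in> sums_of (insert x W). c \<le> C}"
    hence c: "c \<in> sums_of (insert x W)" "c \<le> C" by auto
    then obtain b m where b: "b \<in> sums_of W" "c = b + real m * x"
      using sums_of_insert by blast
    have b0: "0 \<le> b" using sums_of_nonneg[OF b(1) nn] .
    have mx: "0 \<le> real m * x" using x by simp
    have bC: "b \<in> ?B" using b c mx by auto
    show "c \<in> (\<lambda>(b, m). b + real m * x) ` (?B \<times> {..nat \<lfloor>C / x\<rfloor>})"
    proof (cases "x = 0")
      case True
      thus ?thesis using b bC by (intro image_eqI[of _ _ "(b, 0)"]) auto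
    next
      case False
      hence "real m \<le> C / x" using x b c b0 by (simp add: field_simps)
      hence "m \<le> nat \<lfloor>C / x\<rfloor>" by (simp add: le_nat_floor)
      thus ?thesis using b bC by (intro image_eqI[of _ _ "(b, m)"]) auto
    qed
  qed
  moreover have "finite ((\<lambda>(b, m). b + real m * x) ` (?B \<times> {..nat \<lfloor>C / x\<rfloor>}))" using fin by simp
  ultimately show ?case by (rule finite_subset)
qed

lemma move_seq_sums_of:
  "move_seq w n s c t \<Longrightarrow> c \<in> sums_of ((\<lambda>(m, r). w m r) ` ({..<n} \<times> pegs))"
proof (induction rule: move_seq.induct)
  case (step s c t d q)
  have d: "d \<in> {1..n}" "t d \<in> pegs" "q \<in> pegs" "q \<noteq> t d"
    using step.hyps(2) by (auto simp: legal_move_def states_def)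
  have third: "\<exists>r. {p, q, r} = pegs" if "p \<in> pegs" "q \<in> pegs" "q \<noteq> p" for p q
  proof
    show "{p, q, 3 - (p + q)} = pegs"
      using that unfolding pegs_def by (elim insertE emptyE; hypsubst; simp; blast)
  qed
  from third[OF d(2-4)] obtain r where "{t d, q, r} = pegs" ..
  hence "idle_peg (t d) q \<in> pegs" using idle_peg_eq[of "t d" q r] by auto
  hence "w (d - 1) (idle_peg (t d) q) \<in> (\<lambda>(m, r). w m r) ` ({..<n} \<times> pegs)"
    using d(1) by (intro image_eqI[of _ _ "(d - 1, idle_peg (t d) q)"]) auto
  thus ?case using step.IH by (rule sums_of.add[rotated])
qed (rule sums_of.zero)

lemma min_cost_attained:
  assumes "\<And>m r. r \<in> pegs \<Longrightarrow> 0 \<le> w m r" and "{i, j, k} = pegs"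
  shows "move_seq w n (perfect n i) (min_cost w n (perfect n i) (perfect n j)) (perfect n j)"
    and "\<And>c. move_seq w n (perfect n i) c (perfect n j) \<Longrightarrow>
      min_cost w n (perfect n i) (perfect n j) \<le> c"
proof -
  let ?P = "\<lambda>c. move_seq w n (perfect n i) c (perfect n j)"
  let ?W = "(\<lambda>(m, r). w m r) ` ({..<n} \<times> pegs)"
  obtain C where C: "?P C" using move_seq_perfect[OF assms(2)] by blast
  have "finite {c \<in> sums_of ?W. c \<le> C}"
    using assms(1) by (intro finite_sums_of) (auto simp: pegs_def)
  hence fin: "finite {c. ?P c \<and> c \<le> C}"
    by (rule finite_subset[rotated]) (use move_seq_sums_of in blast)
  have "\<exists>m. ?P m \<and> (\<forall>c. ?P c \<longrightarrow> m \<le> c)"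
  proof (intro exI conjI allI impI)
    have m: "Min {c. ?P c \<and> c \<le> C} \<in> {c. ?P c \<and> c \<le> C}" using C by (intro Min_in fin) auto
    thus "?P (Min {c. ?P c \<and> c \<le> C})" by simp
    fix c assume "?P c"
    show "Min {c. ?P c \<and> c \<le> C} \<le> c"
      using m \<open>?P c\<close> by (cases "c \<le> C") (auto intro: Min_le[OF fin])
  qed
  then obtain m where m: "?P m" "\<And>c. ?P c \<Longrightarrow> m \<le> c" by blast
  have eq: "min_cost w n (perfect n i) (perfect n j) = m"
    unfolding min_cost_def using m by (rule Least_equality)
  show "?P (min_cost w n (perfect n i) (perfect n j))"
    unfolding eq by (rule m(1))
  show "min_cost w n (perfect n i) (perfect n j) \<le> c" if "?P c" for c
    unfolding eq using that by (rule m(2))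
qed

end

theory Submission imports Defs begin

text \<open>Let \<open>d r\<close> be the cost of a tower of \<open>n\<close> discs with idle peg \<open>r\<close>. Whenever the largest of
  \<open>n + 1\<close> discs moves, all smaller discs sit on the idle peg of that move, so a solution is a walk
  of the largest disc on the triangle of pegs, interleaved with transfers of whole towers of \<open>n\<close>
  discs. The walk \<open>i \<rightarrow> j\<close> costs \<open>d j + w n k + d i\<close>, and the walk \<open>i \<rightarrow> k \<rightarrow> j\<close> costs
  \<open>d k + w n j + d k + w n i + d k\<close>. These give the upper bound (\<open>tower_cost_Suc_le_direct\<close>,
  \<open>tower_cost_Suc_le_detour\<close>).

  For the lower bound it has to be excluded that a longer walk, circling the triangle or going back
  and forth, is cheaper. Instead of analysing walks, one bounds from below the cost of reaching an
  arbitrary state by an invariant of single moves (\<open>cost_invariant\<close>). It says that a sequence which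
  has brought the largest disc to some peg has paid for the cheapest preliminaries of one of the at
  most two walks without repetition ending there, and that the rest of its budget pays for bringing
  the small discs from the perfect state in which that walk leaves them to where they are now. A
  move of the largest disc forces the small discs into a perfect state, so there the rest of the
  budget is at least a tower cost, which is what the next walk requires. Evaluated in the perfect
  state on \<open>j\<close>, the invariant is the lower bound.\<close>

lemma pegs_distinct:
  assumes "{i, j, k} = pegs"
  shows "i \<noteq> j" "i \<noteq> k" "j \<noteq> k"
proof -
  have "card {i, j, k} = 3" using assms by (simp add: pegs_def)
  thus "i \<noteq> j" "i \<noteq> k" "j \<noteq> k" by (auto simp: card_insert_if split: if_splits)
qed

lemma third_peg:
  assumes "p \<in> pegs" "q \<in> pegs" "p \<noteq> q"
  obtains r where "{p, q, r} = pegs"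
proof
  \<comment> \<open>The three pegs add up to 3.\<close>
  show "{p, q, 3 - (p + q)} = pegs"
    using assms unfolding pegs_def by (elim insertE emptyE; hypsubst; simp; blast)
qed

section \<open>Tower transfers and upper bounds\<close>

locale move_costs =
  fixes w :: "nat \<Rightarrow> nat \<Rightarrow> real"
  assumes cost_nonneg: "\<And>m r. r \<in> pegs \<Longrightarrow> 0 \<le> w m r"
begin

lemma move_seq_nonneg: "move_seq w n s c t \<Longrightarrow> 0 \<le> c"
  by (rule sums_of_nonneg[OF move_seq_sums_of]) (auto simp: cost_nonneg)

lemma tower_cost_attained:
  assumes "{i, j, k} = pegs"
  shows "move_seq w n (perfect n i) (tower_cost w n k) (perfect n j)"
  using min_cost_attained(1)[of w, OF cost_nonneg assms] tower_cost_eq[OF assms] by simp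

lemma tower_cost_le:
  assumes "{i, j, k} = pegs"
    and "move_seq w n (perfect n i) c (perfect n j)"
  shows "tower_cost w n k \<le> c"
  using min_cost_attained(2)[of w, OF cost_nonneg assms] tower_cost_eq[OF assms(1)] by simp

lemma tower_cost_0:
  assumes "{i, j, k} = pegs"
  shows "tower_cost w 0 k = 0"
proof (rule antisym)
  have "perfect 0 i = perfect 0 j" by (auto simp: perfect_def)
  moreover have "perfect 0 i \<in> states 0" using assms by (intro perfect_in_states) auto
  ultimately have "move_seq w 0 (perfect 0 i) 0 (perfect 0 j)" by (metis move_seq.empty)
  from tower_cost_le[OF assms this] show "tower_cost w 0 k \<le> 0" .
  show "0 \<le> tower_cost w 0 k" by (rule move_seq_nonneg[OF tower_cost_attained[OF assms]])
qed

lemma move_seq_tower_under_largest: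
  assumes "{a, b, r} = pegs" "p \<in> pegs"
  shows "move_seq w (Suc n) ((perfect n a)(Suc n := p)) (tower_cost w n r)
           ((perfect n b)(Suc n := p))"
  using move_seq_lift[OF assms(2) tower_cost_attained[OF assms(1)]] .

lemma move_seq_largest:
  assumes "{p, q, r} = pegs"
  shows "move_seq w (Suc n) ((perfect n r)(Suc n := p)) (w n r) ((perfect n r)(Suc n := q))"
  using move_seq_single[OF legal_move_largest[OF assms], of w n] idle_peg_eq[OF assms] by simp

lemma tower_cost_Suc_le_direct:
  assumes p: "{i, j, k} = pegs"
  shows "tower_cost w (Suc n) k \<le> tower_cost w n i + tower_cost w n j + w n k"
proof -
  have q: "{i, k, j} = pegs" "{k, j, i} = pegs" "i \<in> pegs" "j \<in> pegs" using p by auto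
  note start = move_seq_tower_under_largest[OF q(1,3)]
  note middle = move_seq_largest[OF p, of n]
  note finish = move_seq_tower_under_largest[OF q(2,4)]
  from move_seq_append[OF finish move_seq_append[OF middle start]]
  have "move_seq w (Suc n) (perfect (Suc n) i)
      (tower_cost w n j + w n k + tower_cost w n i) (perfect (Suc n) j)"
    by (simp add: perfect_Suc)
  from tower_cost_le[OF p this] show ?thesis by simp
qed

lemma tower_cost_Suc_le_detour:
  assumes p: "{i, j, k} = pegs"
  shows "tower_cost w (Suc n) k \<le> 3 * tower_cost w n k + w n i + w n j"
proof -
  have q: "{j, i, k} = pegs" "{i, k, j} = pegs" "{k, j, i} = pegs" "i \<in> pegs" "j \<in> pegs" "k \<in> pegs"
    using p by auto
  note small1 = move_seq_tower_under_largest[OF p q(4)]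
  note large1 = move_seq_largest[OF q(2), of n]
  note small2 = move_seq_tower_under_largest[OF q(1,6)]
  note large2 = move_seq_largest[OF q(3), of n]
  note small3 = move_seq_tower_under_largest[OF p q(5)]
  from move_seq_append[OF small3 move_seq_append[OF large2
      move_seq_append[OF small2 move_seq_append[OF large1 small1]]]]
  have "move_seq w (Suc n) (perfect (Suc n) i)
      (tower_cost w n k + w n j + tower_cost w n k + w n i + tower_cost w n k) (perfect (Suc n) j)"
    by (simp add: perfect_Suc)
  from tower_cost_le[OF p this] show ?thesis by simp
qed

section \<open>Lower bound\<close>

text \<open>Working with a bound instead of the exact cost of a path turns the invariant below into
  a statement about budgets: a budget between two perfect states is sufficient if and only if it is
  at least the tower cost.\<close>

definition reachable_within ::
  "nat \<Rightarrow> (nat \<Rightarrow> nat) \<Rightarrow> (nat \<Rightarrow> nat) \<Rightarrow> real \<Rightarrow> bool" where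
  "reachable_within n s t b \<longleftrightarrow> (\<exists>c\<le>b. move_seq w n s c t)"

lemma reachable_within_refl: "s \<in> states n \<Longrightarrow> 0 \<le> b \<Longrightarrow> reachable_within n s s b"
  unfolding reachable_within_def using move_seq.empty by blast

lemma reachable_within_mono:
  "reachable_within n s t b \<Longrightarrow> b \<le> b' \<Longrightarrow> reachable_within n s t b'"
  unfolding reachable_within_def using order_trans by blast

lemma reachable_within_nonneg: "reachable_within n s t b \<Longrightarrow> 0 \<le> b"
  unfolding reachable_within_def using move_seq_nonneg order_trans by blast

lemma reachable_within_step:
  assumes "reachable_within n s t b" "legal_move n t d q"
  shows "reachable_within n s (t(d := q)) (b + w (d - 1) (idle_peg (t d) q))"
  using assms move_seq.step unfolding reachable_within_def by (meson add_right_mono)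

lemma tower_cost_le_if_reachable_within:
  assumes "{i, j, k} = pegs"
    and "reachable_within n (perfect n i) (perfect n j) b"
  shows "tower_cost w n k \<le> b"
  using assms(2) tower_cost_le[OF assms(1)] unfolding reachable_within_def
  by (meson order_trans)

lemma reachable_within_tower:
  assumes "{i, j, k} = pegs" "tower_cost w n k \<le> b"
  shows "reachable_within n (perfect n i) (perfect n j) b"
  using assms(2) tower_cost_attained[OF assms(1)] unfolding reachable_within_def by blast

text \<open>Here \<open>p\<close> is the peg of the largest disc, \<open>\<sigma>\<close> the state of the \<open>n\<close> smaller ones and \<open>c\<close> the
  amount spent since the perfect state on \<open>i\<close>. Suppose that \<open>p\<close> is not \<open>i\<close>. The first alternative
  is that of the walk \<open>i \<rightarrow> p\<close>, which finds and leaves the small discs on the third peg \<open>r\<close>. The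
  second is that of the walk \<open>i \<rightarrow> r \<rightarrow> p\<close>: the small discs go to \<open>p\<close> first and are back on \<open>i\<close>
  at the end, which costs \<open>2 * tower_cost w n r\<close>.\<close>

definition paid_for ::
  "nat \<Rightarrow> nat \<Rightarrow> nat \<Rightarrow> (nat \<Rightarrow> nat) \<Rightarrow> real \<Rightarrow> bool" where
  "paid_for n i p \<sigma> c \<longleftrightarrow>
     (p = i \<longrightarrow> reachable_within n (perfect n i) \<sigma> c) \<and>
     (\<forall>r. {i, p, r} = pegs \<longrightarrow>
        reachable_within n (perfect n r) \<sigma> (c - (tower_cost w n p + w n r)) \<or>
        reachable_within n (perfect n i) \<sigma> (c - (2 * tower_cost w n r + w n p + w n i)))"

lemma paid_for_small_move:
  assumes "paid_for n i p \<sigma> c" "legal_move n \<sigma> d q"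
  shows "paid_for n i p (\<sigma>(d := q)) (c + w (d - 1) (idle_peg (\<sigma> d) q))"
proof -
  \<comment> \<open>The clauses of the invariant differ in the starting point \<open>s\<close> and in the amount \<open>x\<close> already
    spent on the walk of the largest disc, which is 0 while that disc is on \<open>i\<close>.\<close>
  have shift: "reachable_within n s (\<sigma>(d := q)) (c + w (d - 1) (idle_peg (\<sigma> d) q) - x)"
    if "reachable_within n s \<sigma> (c - x)" for s x
    using reachable_within_step[OF that assms(2)] by (simp add: algebra_simps)
  show ?thesis
    using assms(1) shift[where x = 0] shift unfolding paid_for_def by auto
qed

text \<open>The heart of the lower bound: since the small discs are in the perfect state on \<open>r\<close>, each
  budget in the hypothesis dominates the cost of a tower transfer, or is at least nonnegative, and
  this is enough to shorten the walk to one without repetition. If the largest disc returns to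
  \<open>i\<close>, the excursion cost no less than transferring the small discs directly from \<open>i\<close> to \<open>r\<close>. If it
  moves on from \<open>p \<noteq> i\<close> to the other peg \<open>q \<noteq> i\<close>, so that \<open>r = i\<close>, then \<open>i \<rightarrow> p\<close> is extended to
  \<open>i \<rightarrow> p \<rightarrow> q\<close>, while \<open>i \<rightarrow> q \<rightarrow> p \<rightarrow> q\<close> is replaced by \<open>i \<rightarrow> q\<close>.\<close>

lemma paid_for_largest_move:
  assumes i: "i \<in> pegs"
    and pqr: "{p, q, r} = pegs" and paid: "paid_for n i p (perfect n r) c"
  shows "paid_for n i q (perfect n r) (c + w n r)"
proof -
  note distinct = pegs_distinct[OF pqr]
  have pegs: "p \<in> pegs" "q \<in> pegs" "r \<in> pegs" using pqr by auto
  have w0: "0 \<le> w n p" "0 \<le> w n q" "0 \<le> w n r" using cost_nonneg pegs by auto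
  have perms: "{p, r, q} = pegs" "{q, p, r} = pegs" "{q, r, p} = pegs" "{r, p, q} = pegs"
      "{r, q, p} = pegs"
    using pqr by auto
  have only: "x = c" if "{a, b, c} = pegs" "{a, b, x} = pegs" for a b c x
    using idle_peg_eq that by metis
  consider "i = p" | "i = q" | "i = r" using i pqr by auto
  thus ?thesis
  proof cases
    case 1
    have "reachable_within n (perfect n p) (perfect n r) c"
      using paid 1 by (simp add: paid_for_def)
    hence "tower_cost w n q \<le> c"
      using tower_cost_le_if_reachable_within[OF perms(1)] by blast
    hence "reachable_within n (perfect n r) (perfect n r) (c + w n r - (tower_cost w n q + w n r))"
      using pegs by (intro reachable_within_refl perfect_in_states) auto
    moreover have "x = r" if "{i, q, x} = pegs" for x using only[OF pqr] that 1 by simp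
    ultimately show ?thesis unfolding paid_for_def using 1 distinct(1) by metis
  next
    case 2
    from paid 2 perms(2) consider
        "reachable_within n (perfect n r) (perfect n r) (c - (tower_cost w n p + w n r))"
      | "reachable_within n (perfect n q) (perfect n r) (c - (2 * tower_cost w n r + w n p + w n q))"
      unfolding paid_for_def by blast
    hence "reachable_within n (perfect n q) (perfect n r) (c + w n r)"
    proof cases
      case 1
      have "tower_cost w n p \<le> c + w n r"
        using reachable_within_nonneg[OF 1] w0 by linarith
      thus ?thesis by (rule reachable_within_tower[OF perms(3)])
    next
      case 2
      have "0 \<le> tower_cost w n r"
        using reachable_within_nonneg[OF reachable_within_tower[OF pqr order_refl]] .
      with w0 show ?thesis by (intro reachable_within_mono[OF 2]) linarith
    qed
    thus ?thesis unfolding paid_for_def using 2 pegs_distinct(1) by blast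
  next
    case 3
    from paid 3 perms(4) consider
        "reachable_within n (perfect n q) (perfect n r) (c - (tower_cost w n p + w n q))"
      | "reachable_within n (perfect n r) (perfect n r) (c - (2 * tower_cost w n q + w n p + w n r))"
      unfolding paid_for_def by blast
    hence "reachable_within n (perfect n p) (perfect n r)
             (c + w n r - (tower_cost w n q + w n p)) \<or>
           reachable_within n (perfect n r) (perfect n r)
             (c + w n r - (2 * tower_cost w n p + w n q + w n r))"
    proof cases
      case 1
      have "tower_cost w n p \<le> c - (tower_cost w n p + w n q)"
        using tower_cost_le_if_reachable_within[OF perms(3) 1] .
      hence "reachable_within n (perfect n r) (perfect n r)
             (c + w n r - (2 * tower_cost w n p + w n q + w n r))"
        using pegs by (intro reachable_within_refl perfect_in_states) auto
      thus ?thesis ..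
    next
      case 2
      \<comment> \<open>Of the two transfers paid for on the way \<open>i \<rightarrow> q \<rightarrow> p\<close>, the first one belongs to
        \<open>i \<rightarrow> q\<close> and the second one brings the small discs from \<open>p\<close> to \<open>r\<close>.\<close>
      have "tower_cost w n q \<le> c + w n r - (tower_cost w n q + w n p)"
        using reachable_within_nonneg[OF 2] w0 by linarith
      from reachable_within_tower[OF perms(1) this] show ?thesis ..
    qed
    moreover have "x = p" if "{i, q, x} = pegs" for x using only[OF perms(5)] that 3 by simp
    ultimately show ?thesis unfolding paid_for_def using 3 distinct(3) by metis
  qed
qed

lemma legal_move_largest_small_discs:
  assumes "legal_move (Suc n) t (Suc n) q" "{t (Suc n), q, r} = pegs"
  shows "restrict t {1..n} = perfect n r"
  unfolding perfect_def
proof (rule restrict_ext)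
  fix e assume e: "e \<in> {1..n}"
  have "t e \<in> pegs" "t e \<noteq> t (Suc n)" "t e \<noteq> q"
    using assms(1) e unfolding legal_move_def states_def by (auto simp: PiE_mem)
  thus "t e = r" unfolding assms(2)[symmetric] by blast
qed

lemma legal_move_small_disc:
  assumes "legal_move (Suc n) t d q" "d \<noteq> Suc n"
  shows "legal_move n (restrict t {1..n}) d q"
    and "restrict (t(d := q)) {1..n} = (restrict t {1..n})(d := q)"
proof -
  have d: "d \<in> {1..n}" using assms unfolding legal_move_def by auto
  have "restrict t {1..n} \<in> states n"
    using assms(1) unfolding legal_move_def states_def by (auto simp: PiE_mem)
  thus "legal_move n (restrict t {1..n}) d q"
    using assms(1) d unfolding legal_move_def by auto
  show "restrict (t(d := q)) {1..n} = (restrict t {1..n})(d := q)"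
    using d by (auto simp: restrict_def)
qed

lemma cost_invariant:
  assumes i: "i \<in> pegs"
    and "move_seq w (Suc n) s c t" "s = perfect (Suc n) i"
  shows "paid_for n i (t (Suc n)) (restrict t {1..n}) c"
  using assms(2,3)
proof (induction rule: move_seq.induct)
  case (empty s)
  have "restrict s {1..n} = perfect n i" "s (Suc n) = i"
    using empty.prems by (auto simp: perfect_def)
  moreover have "reachable_within n (perfect n i) (perfect n i) 0"
    by (intro reachable_within_refl perfect_in_states i order_refl)
  ultimately show ?case unfolding paid_for_def using pegs_distinct(1) by metis
next
  case (step s c t d q)
  note paid = step.IH[OF step.prems]
  show ?case
  proof (cases "d = Suc n")
    case True
    have "t (Suc n) \<in> pegs" "q \<in> pegs" "t (Suc n) \<noteq> q"
      using step.hyps(2) True by (auto simp: legal_move_def states_def)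
    then obtain r where r: "{t (Suc n), q, r} = pegs" by (rule third_peg)
    have small: "restrict t {1..n} = perfect n r"
      using legal_move_largest_small_discs step.hyps(2) True r by blast
    have "paid_for n i q (perfect n r) (c + w n r)"
      using paid by (intro paid_for_largest_move[OF i r]) (simp only: small)
    moreover have "restrict (t(d := q)) {1..n} = perfect n r"
      unfolding small[symmetric] True by (rule restrict_ext) simp
    moreover have "(t(d := q)) (Suc n) = q" "w (d - 1) (idle_peg (t d) q) = w n r"
      using idle_peg_eq[OF r] True by simp_all
    ultimately show ?thesis by (simp only:)
  next
    case False
    note small = legal_move_small_disc[OF step.hyps(2) False]
    have "restrict t {1..n} d = t d" "(t(d := q)) (Suc n) = t (Suc n)"
      using small(1) False by (auto simp: legal_move_def)
    with paid_for_small_move[OF paid small(1)] show ?thesis by (simp only: small(2))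
  qed
qed

text \<open>In the perfect state on \<open>j\<close> the walk \<open>i \<rightarrow> j\<close> still owes the transfer of the small discs from
  \<open>k\<close>, and the walk \<open>i \<rightarrow> k \<rightarrow> j\<close> owes the one from \<open>i\<close>.\<close>

lemma tower_cost_Suc_ge:
  assumes p: "{i, j, k} = pegs"
  shows "tower_cost w n i + tower_cost w n j + w n k \<le> tower_cost w (Suc n) k \<or>
         3 * tower_cost w n k + w n i + w n j \<le> tower_cost w (Suc n) k"
proof -
  have i: "i \<in> pegs" and q: "{k, j, i} = pegs" using p by auto
  have "restrict (perfect (Suc n) j) {1..n} = perfect n j" "perfect (Suc n) j (Suc n) = j"
    by (auto simp: perfect_def)
  with cost_invariant[OF i tower_cost_attained[OF p] refl, of n]
  have "paid_for n i j (perfect n j) (tower_cost w (Suc n) k)" by (simp only:)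
  then consider
      "reachable_within n (perfect n k) (perfect n j)
         (tower_cost w (Suc n) k - (tower_cost w n j + w n k))"
    | "reachable_within n (perfect n i) (perfect n j)
         (tower_cost w (Suc n) k - (2 * tower_cost w n k + w n j + w n i))"
    using p unfolding paid_for_def by blast
  thus ?thesis
  proof cases
    case 1
    from tower_cost_le_if_reachable_within[OF q this] show ?thesis by linarith
  next
    case 2
    from tower_cost_le_if_reachable_within[OF p this] show ?thesis by linarith
  qed
qed

end

theorem theorem1:
  fixes w :: "nat \<Rightarrow> nat \<Rightarrow> real" and i j k n :: nat
  assumes "\<And>m r. r \<in> pegs \<Longrightarrow> 0 \<le> w m r"
    and "{i, j, k} = pegs"
  shows "tower_cost w 0 k = 0 \<and>
    tower_cost w (n + 1) k =
      min (tower_cost w n i + tower_cost w n j + w n k)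
          (3 * tower_cost w n k + w n i + w n j)"
proof -
  interpret move_costs w using assms(1) by unfold_locales
  show ?thesis
    using tower_cost_0[OF assms(2)] tower_cost_Suc_le_direct[OF assms(2), of n]
      tower_cost_Suc_le_detour[OF assms(2), of n] tower_cost_Suc_ge[OF assms(2), of n]
    by (auto simp: min_def)
qed

end
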